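(* Let $G$ be a connected finite simple graph on $n$ vertices with $m$ edges. Then there is an optimal set of vertices for $T^+(G)$ that has at most $m-n+1$ vertices, and there is an optimal set of vertices for $T^-(G)$ that has at most $m-n+1$ vertices.
   Context: Graphs are finite and simple. The path cover number $P(G)$ is the minimum number of vertex-disjoint paths, each occurring as an induced subgraph of $G$, that cover all the vertices of $G$ (a single vertex counts as a path; the graph with no vertices has path cover number $0$). For a set $S$ of vertices of $G$, $G\setminus S$ is the induced subgraph obtained by deleting $S$. Define $$T^-(G)=\max\{P(G\setminus S)-|S| : S\subseteq V(G),\ G\setminus S \text{ is a forest}\},$$ $$T^+(G)=\min\{P(G\setminus S)+|S| : S\subseteq V(G),\ G\setminus S \text{ is a forest}\}.$$ A set $S\subseteq V(G)$ is an optimal set of vertices for $T^+(G)$ (respectively $T^-(G)$) if $G\setminus S$ is a forest and $P(G\setminus S)+|S|=T^+(G)$ (respectively $P(G\setminus S)-|S|=T^-(G)$). *)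

theory Defs
  imports
    "Graph_Theory.Digraph_Component"
    "Graph_Theory.Vertex_Walk"
    "HOL-Library.Disjoint_Sets"
begin

text \<open>
  A finite simple graph is a digraph satisfying the locale predicate \<^const>\<open>graph\<close>: finite,
  loop-free, without parallel arcs and symmetric. An undirected edge is thus represented by
  two opposite arcs, and edges are counted as two-element sets of vertices.
\<close>

definition undirected_edges :: "('a, 'b) pre_digraph \<Rightarrow> 'a set set" where
  "undirected_edges G = (\<lambda>e. {tail G e, head G e}) ` arcs G"

text \<open>
  The constant \<^const>\<open>forest\<close> is not usable here: in a symmetric digraph it counts a pair of
  opposite arcs as a cycle. The bound on the length excludes exactly these (and loops).
\<close>

definition undirected_forest :: "('a, 'b) pre_digraph \<Rightarrow> bool" where
  "undirected_forest G \<longleftrightarrow> \<not> (\<exists>p. pre_digraph.cycle G p \<and> 3 \<le> length p)"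

text \<open>
  The graph is itself a path, possibly a single vertex (\<^const>\<open>vpath\<close> requires \<open>p \<noteq> []\<close>):
  there are no adjacencies besides those between consecutive vertices of \<open>p\<close>.
\<close>

definition path_graph :: "('a, 'b) pre_digraph \<Rightarrow> bool" where
  "path_graph G \<longleftrightarrow> (\<exists>p. vpath p G \<and> set p = verts G \<and>
     arcs_ends G = set (vwalk_arcs p) \<union> (set (vwalk_arcs p))\<inverse>)"

text \<open>Induced paths are represented by their vertex sets.\<close>

definition path_cover :: "('a, 'b) pre_digraph \<Rightarrow> 'a set set \<Rightarrow> bool" where
  "path_cover G C \<longleftrightarrow> partition_on (verts G) C \<and> (\<forall>A\<in>C. path_graph (G \<restriction> A))"

definition path_cover_number :: "('a, 'b) pre_digraph \<Rightarrow> nat" where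
  "path_cover_number G = (LEAST k. \<exists>C. path_cover G C \<and> card C = k)"

definition del_verts :: "('a, 'b) pre_digraph \<Rightarrow> 'a set \<Rightarrow> ('a, 'b) pre_digraph" where
  "del_verts G S = G \<restriction> (verts G - S)"

definition T_minus :: "('a, 'b) pre_digraph \<Rightarrow> int" where
  "T_minus G = Max {int (path_cover_number (del_verts G S)) - int (card S) |S.
     S \<subseteq> verts G \<and> undirected_forest (del_verts G S)}"

definition T_plus :: "('a, 'b) pre_digraph \<Rightarrow> int" where
  "T_plus G = Min {int (path_cover_number (del_verts G S)) + int (card S) |S.
     S \<subseteq> verts G \<and> undirected_forest (del_verts G S)}"

definition optimal_T_minus :: "('a, 'b) pre_digraph \<Rightarrow> 'a set \<Rightarrow> bool" where
  "optimal_T_minus G S \<longleftrightarrow> S \<subseteq> verts G \<and> undirected_forest (del_verts G S) \<and>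
     int (path_cover_number (del_verts G S)) - int (card S) = T_minus G"

definition optimal_T_plus :: "('a, 'b) pre_digraph \<Rightarrow> 'a set \<Rightarrow> bool" where
  "optimal_T_plus G S \<longleftrightarrow> S \<subseteq> verts G \<and> undirected_forest (del_verts G S) \<and>
     int (path_cover_number (del_verts G S)) + int (card S) = T_plus G"

end

theory Submission
  imports Defs
begin

text \<open>
  Returning a vertex \<open>v\<close> of a deletion set \<open>S\<close> to \<open>G \<setminus> S\<close> changes the path cover number by at
  most one: a cover of \<open>G \<setminus> S\<close> is extended by the one-vertex path \<open>v\<close>, and a cover that
  contains \<open>v\<close> loses \<open>v\<close> by breaking one path into at most two. At the same time \<open>|S|\<close> drops by
  one, so \<open>P(G \<setminus> S) + |S|\<close> does not increase and \<open>P(G \<setminus> S) - |S|\<close> does not decrease. Hence an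
  optimal set stays optimal under the return of any vertex that leaves the graph a forest
  (\<open>optimal_T_plus_return_vertex\<close>, \<open>optimal_T_minus_return_vertex\<close>), and an optimal set \<open>S\<close> of least
  cardinality is irredundant: each \<open>v \<in> S\<close> closes a cycle when it is returned on its own.

  It remains to bound irredundant sets (\<open>irredundant_deletion_set_bound\<close>). The cycle closed by
  \<open>v\<close> lies in \<open>(G \<setminus> S) + v\<close> and passes through \<open>v\<close>; let \<open>{v, f v}\<close> be an edge of it. As
  \<open>f v \<notin> S\<close>, these edges are distinct for distinct \<open>v\<close>. Delete all of them at once. The rest of
  the cycle of \<open>v\<close> meets \<open>S\<close> only in \<open>v\<close>, so it loses no edge to another vertex of \<open>S\<close>, and it
  still joins \<open>f v\<close> to \<open>v\<close>. The graph therefore remains connected on \<open>n\<close> vertices with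
  \<open>m - |S|\<close> edges, so that \<open>n - 1 \<le> m - |S|\<close>.
\<close>

section \<open>Reachability and the number of edges\<close>

text \<open>
  A breadth-first search tree from \<open>r\<close> provides the edges: each \<open>v \<noteq> r\<close> has a predecessor that is
  strictly closer to \<open>r\<close>, and an edge determines which of its ends is the farther one, so
  different vertices use different edges.
\<close>
lemma card_reachable_le_card_edges:
  assumes fin: "finite R" and reach: "\<And>v. v \<in> V \<Longrightarrow> (r, v) \<in> R\<^sup>*"
  shows "card V \<le> card ((\<lambda>(x, y). {x, y}) ` R) + 1"
proof -
  define d where "d v = (LEAST k. (r, v) \<in> R ^^ k)" for v
  have "\<exists>u. (u, v) \<in> R \<and> d u < d v" if "v \<in> V - {r}" for v
  proof -
    from reach that have "\<exists>k. (r, v) \<in> R ^^ k" by (simp add: rtrancl_power)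
    then have dv: "(r, v) \<in> R ^^ d v" unfolding d_def by (rule LeastI_ex)
    with that obtain k where k: "d v = Suc k" by (cases "d v") auto
    with dv obtain u where u: "(r, u) \<in> R ^^ k" "(u, v) \<in> R" by auto
    then have "d u \<le> k" unfolding d_def by (intro Least_le)
    with k u show ?thesis by auto
  qed
  then obtain f where f: "\<And>v. v \<in> V - {r} \<Longrightarrow> (f v, v) \<in> R \<and> d (f v) < d v" by metis
  have "inj_on (\<lambda>v. {f v, v}) (V - {r})"
  proof (rule inj_onI)
    fix v w assume vw: "v \<in> V - {r}" "w \<in> V - {r}" "{f v, v} = {f w, w}"
    then show "v = w" using f[of v] f[of w] by (auto simp: doubleton_eq_iff)
  qed
  moreover have "(\<lambda>v. {f v, v}) ` (V - {r}) \<subseteq> (\<lambda>(x, y). {x, y}) ` R"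
    using f by force
  ultimately have "card (V - {r}) \<le> card ((\<lambda>(x, y). {x, y}) ` R)"
    using fin by (intro card_inj_on_le) auto
  moreover have "card V \<le> card (V - {r}) + 1"
    by (cases "finite V") (auto simp: card_Diff_singleton_if)
  ultimately show ?thesis by simp
qed

section \<open>Cycles\<close>

lemma (in wf_digraph) awalk_in_rtrancl:
  assumes "awalk u p v"
  shows "(u, v) \<in> (arc_to_ends G ` set p)\<^sup>*"
  using assms
proof (induct p arbitrary: u)
  case Nil
  then show ?case by (simp add: awalk_Nil_iff)
next
  case (Cons e es)
  then have "(head G e, v) \<in> (arc_to_ends G ` set (e # es))\<^sup>*" "u = tail G e"
    by (auto simp: awalk_Cons_iff intro: rtrancl_mono[THEN subsetD, rotated])
  then show ?case
    by (auto simp: arc_to_ends_def intro: converse_rtrancl_into_rtrancl)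
qed

lemma (in wf_digraph) head_last_awalk:
  assumes "awalk u p v" "p \<noteq> []"
  shows "head G (last p) = v"
  using assms by (auto simp: awalk_verts_conv)

text \<open>
  The rest of the cycle leads from the head of \<open>a\<close> back to its tail. It could use the reversed arc
  only if it consisted of that arc alone, and this is what the bound on the length excludes.
\<close>
lemma (in wf_digraph) cycle_bypasses_arc:
  assumes cyc: "cycle p" and len: "3 \<le> length p" and a: "a \<in> set p"
  shows "(head G a, tail G a) \<in>
    (arcs_ends G - {(tail G a, head G a), (head G a, tail G a)})\<^sup>*"
proof -
  from cyc obtain u where u: "awalk u p u" "distinct (tl (awalk_verts u p))" "p \<noteq> []"
    unfolding cycle_def by blast
  from u(1) have "cas u p u" by auto
  with u have dist: "distinct (map (head G) p)" by (simp add: awalk_verts_conv')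
  from a obtain p1 p2 where p: "p = p1 @ a # p2" by (auto simp: in_set_conv_decomp)
  define q where "q = p2 @ p1"
  from u(1) have "awalk u p1 (awlast u p1)" "awlast u p1 = tail G a" "awalk (head G a) p2 u"
    unfolding p by (auto simp: awalk_Cons_iff)
  then have walk: "awalk (head G a) q (tail G a)"
    unfolding q_def by (metis awalk_appendI)
  have dq: "distinct (map (head G) (a # q))" using dist unfolding p q_def by auto
  have "arc_to_ends G b \<noteq> (tail G a, head G a) \<and> arc_to_ends G b \<noteq> (head G a, tail G a)"
    if b: "b \<in> set q" for b
  proof (intro conjI notI)
    assume "arc_to_ends G b = (tail G a, head G a)"
    then have "head G b = head G a" by (simp add: arc_to_ends_def)
    with b dq show False by (metis distinct.simps(2) image_eqI list.set_map list.simps(9))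
  next
    assume "arc_to_ends G b = (head G a, tail G a)"
    then have ends: "tail G b = head G a" "head G b = tail G a"
      by (auto simp: arc_to_ends_def)
    from b obtain q1 q2 where q: "q = q1 @ b # q2" by (auto simp: in_set_conv_decomp)
    have w: "awalk (head G a) q1 (head G a)" "awalk (tail G a) q2 (tail G a)"
      using walk unfolding q by (auto simp: awalk_Cons_iff ends)
    \<comment> \<open>Both \<open>q1\<close> and \<open>q2\<close> are closed; a nonempty one would repeat the head of \<open>a\<close> or of \<open>b\<close>.\<close>
    have "q1 = []"
    proof (rule ccontr)
      assume "q1 \<noteq> []"
      with head_last_awalk[OF w(1)] dq show False unfolding q
        by (metis Un_iff distinct.simps(2) image_eqI last_in_set list.set_map list.simps(9) set_append)
    qed
    moreover have "q2 = []"
    proof (rule ccontr)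
      assume ne: "q2 \<noteq> []"
      then have "head G b \<in> head G ` set q2"
        using head_last_awalk[OF w(2)] ends by (metis image_eqI last_in_set)
      with dq show False unfolding q by auto
    qed
    ultimately show False using len q unfolding p q_def
      by (metis One_nat_def Suc_eq_plus1 add.commute append_Nil length_Cons length_append list.size(3) not_less_eq_eq numeral_3_eq_3 add_Suc_right le_refl)
  qed
  moreover have "arc_to_ends G ` set q \<subseteq> arcs_ends G"
    using walk by (auto simp: arcs_ends_def)
  ultimately have "arc_to_ends G ` set q \<subseteq>
      arcs_ends G - {(tail G a, head G a), (head G a, tail G a)}" by fastforce
  from rtrancl_mono[OF this] awalk_in_rtrancl[OF walk] show ?thesis by blast
qed

lemma arcs_ends_induce_subgraph: "arcs_ends (G \<restriction> A) = arcs_ends G \<inter> A \<times> A"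
  by (auto simp: arcs_ends_conv)

lemma (in wf_digraph) cycle_avoiding_vertex:
  assumes cyc: "pre_digraph.cycle (G \<restriction> insert v A) p"
    and v: "v \<notin> tail G ` set p"
  shows "pre_digraph.cycle (G \<restriction> A) p"
proof -
  let ?H = "G \<restriction> insert v A" and ?F = "G \<restriction> A"
  interpret H: wf_digraph ?H by auto
  interpret F: wf_digraph ?F by auto
  from cyc obtain u where u: "H.awalk u p u" "distinct (tl (H.awalk_verts u p))" "p \<noteq> []"
    unfolding H.cycle_def by blast
  have verts: "H.awalk_verts u p = F.awalk_verts u p"
    by (simp add: H.awalk_verts_conv F.awalk_verts_conv)
  have tails: "tail G ` set p \<subseteq> A" using u(1) v by (auto simp: H.awalk_def)
  have "u = tail G (hd p)" using u(1,3) by (cases p) (auto simp: H.awalk_def)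
  with u(3) tails have uA: "u \<in> A" by auto
  have "set (H.awalk_verts u p) = insert u (tail G ` set p)"
    using H.head_last_awalk[OF u(1,3)] u(3) by (auto simp: H.awalk_verts_conv)
  then have "head G ` set p \<subseteq> insert u (tail G ` set p)"
    using H.set_awalk_verts[OF u(1)] by auto
  with tails uA have "head G ` set p \<subseteq> A" by blast
  with u(1) tails have "set p \<subseteq> arcs ?F" by (auto simp: H.awalk_def)
  moreover have "F.cas u p u"
    using u(1) compatible_cas[OF compatible_induce_subgraph] by (metis H.awalk_def)
  ultimately have "F.awalk u p u" using uA by (auto simp: F.awalk_def)
  with u(2,3) verts show ?thesis unfolding F.cycle_def by auto
qed

section \<open>Path covers under deletion of a vertex\<close>

lemma path_graph_induce_subgraph:
  "path_graph (G \<restriction> A) \<longleftrightarrow> (\<exists>p. p \<noteq> [] \<and> distinct p \<and> set p = A \<and>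
     arcs_ends G \<inter> A \<times> A = set (vwalk_arcs p) \<union> (set (vwalk_arcs p))\<inverse>)"
  unfolding path_graph_def vpath_def vwalk_def arcs_ends_induce_subgraph by auto

lemma path_cover_induce_subgraph:
  "path_cover (G \<restriction> W) C \<longleftrightarrow> partition_on W C \<and> (\<forall>A\<in>C. path_graph (G \<restriction> A))"
proof -
  have "(G \<restriction> W) \<restriction> A = G \<restriction> A" if "A \<subseteq> W" for A
    using that unfolding induce_subgraph_def by auto
  then show ?thesis
    unfolding path_cover_def partition_on_def by (metis Sup_upper induce_subgraph_verts)
qed

lemma vwalk_arcs_subset: "set (vwalk_arcs p) \<subseteq> set p \<times> set p"
  by (induct p rule: vwalk_arcs.induct) auto

lemma vwalk_arcs_append_restrict:
  assumes "distinct (p @ q)"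
  shows "set (vwalk_arcs (p @ q)) \<inter> set p \<times> set p = set (vwalk_arcs p)"
    and "set (vwalk_arcs (p @ q)) \<inter> set q \<times> set q = set (vwalk_arcs q)"
proof -
  have disj: "set p \<inter> set q = {}" using assms by auto
  have "set (vwalk_arcs (p @ q)) \<inter> set p \<times> set p = set (vwalk_arcs p) \<and>
    set (vwalk_arcs (p @ q)) \<inter> set q \<times> set q = set (vwalk_arcs q)"
  proof (cases "p = [] \<or> q = []")
    case True
    then show ?thesis using vwalk_arcs_subset[of p] vwalk_arcs_subset[of q] by auto
  next
    case False
    then have eq: "set (vwalk_arcs (p @ q)) =
        insert (last p, hd q) (set (vwalk_arcs p) \<union> set (vwalk_arcs q))"
      by (simp add: vwalk_arcs_append)
    from False have "last p \<in> set p" "hd q \<in> set q" by auto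
    with disj have new: "last p \<notin> set q" "hd q \<notin> set p" by auto
    have "set (vwalk_arcs p) \<inter> set q \<times> set q = {}" "set (vwalk_arcs q) \<inter> set p \<times> set p = {}"
      using disj vwalk_arcs_subset[of p] vwalk_arcs_subset[of q] by auto
    then show ?thesis
      using new vwalk_arcs_subset[of p] vwalk_arcs_subset[of q] unfolding eq
      by (simp add: Int_insert_left Int_Un_distrib2 Int_absorb2)
  qed
  then show "set (vwalk_arcs (p @ q)) \<inter> set p \<times> set p = set (vwalk_arcs p)"
    and "set (vwalk_arcs (p @ q)) \<inter> set q \<times> set q = set (vwalk_arcs q)" by auto
qed

text \<open>
  The parts \<open>B\<close> and \<open>C\<close> are the vertices before and after \<open>v\<close> on the path; one of them is empty when
  \<open>v\<close> is an end. They induce paths because no edge of an induced path joins vertices that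
  are not consecutive on it.
\<close>
lemma path_graph_remove_vertex:
  assumes "path_graph (G \<restriction> A)" "v \<in> A"
  obtains B C where "A - {v} = B \<union> C" "B \<inter> C = {}"
    "B = {} \<or> path_graph (G \<restriction> B)" "C = {} \<or> path_graph (G \<restriction> C)"
proof -
  from assms(1) obtain p where p: "distinct p" "set p = A"
    and E: "arcs_ends G \<inter> A \<times> A = set (vwalk_arcs p) \<union> (set (vwalk_arcs p))\<inverse>"
    unfolding path_graph_induce_subgraph by metis
  from assms(2) p obtain q r where qr: "p = q @ v # r" by (auto simp: in_set_conv_decomp)
  have part: "set s = {} \<or> path_graph (G \<restriction> set s)"
    if "distinct s" "set s \<subseteq> A" "set (vwalk_arcs p) \<inter> set s \<times> set s = set (vwalk_arcs s)" for s
  proof -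
    have "arcs_ends G \<inter> set s \<times> set s = (arcs_ends G \<inter> A \<times> A) \<inter> set s \<times> set s"
      using that(2) by blast
    also have "\<dots> = set (vwalk_arcs s) \<union> (set (vwalk_arcs s))\<inverse>"
      unfolding E that(3)[symmetric] by auto
    finally show ?thesis using that(1) unfolding path_graph_induce_subgraph by auto
  qed
  show ?thesis
  proof (rule that[of "set q" "set r"])
    show "A - {v} = set q \<union> set r" "set q \<inter> set r = {}" using p qr by auto
    show "set q = {} \<or> path_graph (G \<restriction> set q)"
    proof (rule part)
      show "set (vwalk_arcs p) \<inter> set q \<times> set q = set (vwalk_arcs q)"
        using p(1) unfolding qr by (rule vwalk_arcs_append_restrict(1))
    qed (use p qr in auto)
    show "set r = {} \<or> path_graph (G \<restriction> set r)"
    proof (rule part)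
      have "p = (q @ [v]) @ r" using qr by simp
      with p(1) show "set (vwalk_arcs p) \<inter> set r \<times> set r = set (vwalk_arcs r)"
        by (simp only: vwalk_arcs_append_restrict(2))
    qed (use p qr in auto)
  qed
qed

lemma path_cover_number_le: "path_cover G C \<Longrightarrow> path_cover_number G \<le> card C"
  unfolding path_cover_number_def by (intro Least_le) blast

context loopfree_digraph
begin

lemma path_graph_singleton: "path_graph (G \<restriction> {v})"
  unfolding path_graph_induce_subgraph
  by (rule exI[of _ "[v]"]) (auto simp: arcs_ends_conv dest: no_loops)

lemma path_cover_number_attained:
  obtains C where "path_cover (G \<restriction> W) C" "card C = path_cover_number (G \<restriction> W)"
proof -
  have "path_cover (G \<restriction> W) ((\<lambda>v. {v}) ` W)"
    unfolding path_cover_induce_subgraph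
    by (auto simp: path_graph_singleton partition_on_def disjoint_def)
  then have "\<exists>k C. path_cover (G \<restriction> W) C \<and> card C = k" by metis
  then have "\<exists>C. path_cover (G \<restriction> W) C \<and> card C = path_cover_number (G \<restriction> W)"
    unfolding path_cover_number_def by (rule LeastI_ex)
  with that show thesis by metis
qed

lemma path_cover_number_insert_le:
  assumes "finite W" "v \<notin> W"
  shows "path_cover_number (G \<restriction> insert v W) \<le> path_cover_number (G \<restriction> W) + 1"
proof -
  obtain C where C: "path_cover (G \<restriction> W) C" "card C = path_cover_number (G \<restriction> W)"
    by (rule path_cover_number_attained)
  have "path_cover (G \<restriction> insert v W) (insert {v} C)"
    using C(1) assms(2) unfolding path_cover_induce_subgraph
    by (auto simp: path_graph_singleton partition_on_def disjoint_def)
  from path_cover_number_le[OF this] C(2) show ?thesis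
    using card_insert_le_m1 by (metis Suc_eq_plus1 card_insert_if card.infinite
      dual_order.trans finite_insert le_SucI le_refl)
qed

text \<open>
  In a cover of \<open>insert v W\<close> only the path through \<open>v\<close> is affected by the removal of \<open>v\<close>, and what
  is left of it consists of at most two paths.
\<close>
lemma path_cover_number_le_insert:
  assumes "finite W" "v \<notin> W"
  shows "path_cover_number (G \<restriction> W) \<le> path_cover_number (G \<restriction> insert v W) + 1"
proof -
  obtain D where D: "path_cover (G \<restriction> insert v W) D"
      "card D = path_cover_number (G \<restriction> insert v W)"
    by (rule path_cover_number_attained)
  then have part: "partition_on (insert v W) D" and paths: "\<And>A. A \<in> D \<Longrightarrow> path_graph (G \<restriction> A)"
    unfolding path_cover_induce_subgraph by auto
  have finD: "finite D" using assms(1) part by (auto intro: finite_elements)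
  from part obtain A where A: "A \<in> D" "v \<in> A" unfolding partition_on_def by blast
  obtain B C where BC: "A - {v} = B \<union> C" "B \<inter> C = {}"
      "B = {} \<or> path_graph (G \<restriction> B)" "C = {} \<or> path_graph (G \<restriction> C)"
    using path_graph_remove_vertex[OF paths[OF A(1)] A(2)] by metis
  define E where "E = (D - {A}) \<union> ({B, C} - {{}})"
  have disj: "X \<inter> A = {}" if "X \<in> D - {A}" for X
    using that A(1) part by (auto simp: partition_on_def disjoint_def)
  define U where "U = \<Union>(D - {A})"
  have "v \<notin> U" using disj A(2) unfolding U_def by blast
  have "W = insert v W - {v}" using assms(2) by simp
  also have "insert v W = U \<union> A"
    using part A(1) unfolding partition_on_def U_def by blast
  also have "(U \<union> A) - {v} = U \<union> (A - {v})" using \<open>v \<notin> U\<close> by auto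
  finally have "W = U \<union> (A - {v})" .
  then have "\<Union>E = W" unfolding E_def BC(1) U_def by auto
  moreover have "disjoint E"
  proof -
    have "B \<subseteq> A" "C \<subseteq> A" using BC(1) by auto
    moreover have "disjoint D" using part by (simp add: partition_on_def)
    ultimately show ?thesis using disj BC(2) unfolding E_def disjoint_def by blast
  qed
  moreover have "{} \<notin> E" using part unfolding E_def partition_on_def by auto
  ultimately have "path_cover (G \<restriction> W) E"
    using BC(3,4) paths unfolding path_cover_induce_subgraph
    by (auto simp: partition_on_def E_def)
  then have "path_cover_number (G \<restriction> W) \<le> card E" by (rule path_cover_number_le)
  also have "card E \<le> card (D - {A}) + card ({B, C} - {{}})" unfolding E_def by (rule card_Un_le)
  also have "\<dots> \<le> card (D - {A}) + 2"
    using card_mono[of "{B, C}" "{B, C} - {{}}"] card_insert_le_m1[of 2 "{C}" B] by auto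
  also have "\<dots> = card D + 1"
    using finD A(1) by (metis Suc_eq_plus1 add_2_eq_Suc' card_Suc_Diff1)
  finally show ?thesis using D(2) by simp
qed

end

section \<open>Irredundant deletion sets\<close>

context graph
begin

text \<open>
  Since \<open>G \<setminus> S\<close> is a forest, the cycle that appears together with \<open>v\<close> passes through \<open>v\<close>. The
  vertex \<open>w\<close> is the successor of \<open>v\<close> on this cycle, and the rest of the cycle leads from \<open>w\<close> back
  to \<open>v\<close> without the edge \<open>{v, w}\<close>.
\<close>
lemma returned_vertex_closes_cycle:
  assumes S: "S \<subseteq> verts G" "v \<in> S"
    and forest: "undirected_forest (del_verts G S)"
    and not_forest: "\<not> undirected_forest (del_verts G (S - {v}))"
  obtains w where "w \<notin> S" "(v, w) \<in> arcs_ends G"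
    "(w, v) \<in> (arcs_ends (del_verts G (S - {v})) - {(v, w), (w, v)})\<^sup>*"
proof -
  let ?H = "del_verts G (S - {v})"
  have H: "?H = G \<restriction> insert v (verts G - S)"
    using S unfolding del_verts_def by (auto intro: arg_cong[where f = "(\<restriction>) G"])
  interpret H: wf_digraph ?H unfolding H by auto
  from not_forest obtain p where p: "H.cycle p" "3 \<le> length p"
    unfolding undirected_forest_def by blast
  have "v \<in> tail G ` set p"
    using cycle_avoiding_vertex[of v "verts G - S" p] p forest
    unfolding undirected_forest_def H by (auto simp: del_verts_def)
  then obtain a where a: "a \<in> set p" "tail G a = v" by auto
  from p(1) a(1) have "a \<in> arcs ?H" by (auto simp: H.cycle_def H.awalk_def)
  then have aG: "a \<in> arcs G" "head G a \<in> insert v (verts G - S)" by (auto simp: H)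
  with no_loops[of a] a(2) have "head G a \<notin> S" by auto
  moreover have "(v, head G a) \<in> arcs_ends G" using aG(1) a(2) by (auto simp: arcs_ends_conv)
  moreover have "(head G a, v) \<in> (arcs_ends ?H - {(v, head G a), (head G a, v)})\<^sup>*"
    using H.cycle_bypasses_arc[OF p a(1)] a(2) by (simp add: H)
  ultimately show thesis by (rule that)
qed

text \<open>
  One edge is removed for each vertex of \<open>S\<close>, all at once and without destroying connectivity;
  what is left still has at least \<open>card (verts G) - 1\<close> edges.
\<close>
lemma irredundant_deletion_set_bound:
  assumes conn: "connected G" and S: "S \<subseteq> verts G"
    and forest: "undirected_forest (del_verts G S)"
    and irredundant: "\<And>v. v \<in> S \<Longrightarrow> \<not> undirected_forest (del_verts G (S - {v}))"
  shows "card (verts G) + card S \<le> card (undirected_edges G) + 1"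
proof -
  let ?R = "arcs_ends G" and ?edges = "\<lambda>R. (\<lambda>(x, y). {x, y}) ` R"
  have "\<exists>w. w \<notin> S \<and> (v, w) \<in> ?R \<and>
      (w, v) \<in> (arcs_ends (del_verts G (S - {v})) - {(v, w), (w, v)})\<^sup>*" if "v \<in> S" for v
    using returned_vertex_closes_cycle[OF S that forest irredundant[OF that]] by metis
  then obtain f where f: "\<And>v. v \<in> S \<Longrightarrow> f v \<notin> S" "\<And>v. v \<in> S \<Longrightarrow> (v, f v) \<in> ?R"
    and bypass: "\<And>v. v \<in> S \<Longrightarrow>
      (f v, v) \<in> (arcs_ends (del_verts G (S - {v})) - {(v, f v), (f v, v)})\<^sup>*"
    by metis
  define K where "K = (\<Union>v\<in>S. {(v, f v), (f v, v)})"
  define R where "R = ?R - K"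
  have symG: "sym ?R" using sym_arcs by (simp add: symmetric_def)
  then have symR: "sym R" unfolding R_def K_def sym_def by blast
  have returns: "(f v, v) \<in> R\<^sup>*" if v: "v \<in> S" for v
  proof -
    \<comment> \<open>A removed edge of another vertex of \<open>S\<close> has an end in \<open>S - {v}\<close>, hence is no edge of
      \<open>del_verts G (S - {v})\<close>.\<close>
    have "arcs_ends (del_verts G (S - {v})) - {(v, f v), (f v, v)} \<subseteq> R"
      unfolding R_def K_def del_verts_def arcs_ends_induce_subgraph by auto
    from rtrancl_mono[OF this] bypass[OF v] show ?thesis by blast
  qed
  have "?R \<subseteq> R\<^sup>*"
  proof
    fix e assume e: "e \<in> ?R"
    show "e \<in> R\<^sup>*"
    proof (cases "e \<in> K")
      case True
      then obtain v where v: "v \<in> S" "e = (v, f v) \<or> e = (f v, v)" unfolding K_def by auto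
      then show ?thesis using returns[OF v(1)] sym_rtrancl[OF symR] by (auto dest: symD)
    next
      case False
      with e show ?thesis unfolding R_def by auto
    qed
  qed
  then have reachR: "?R\<^sup>* \<subseteq> R\<^sup>*" using rtrancl_subset_rtrancl by blast
  have "strongly_connected G"
    using symmetric_connected_imp_strongly_connected conn sym_arcs by blast
  then obtain r where r: "\<And>v. v \<in> verts G \<Longrightarrow> (r, v) \<in> ?R\<^sup>*"
    unfolding strongly_connected_def by (metis ex_in_conv reachable_rtranclI)
  have finR: "finite ?R" by (simp add: arcs_ends_conv)
  have "card (verts G) \<le> card (?edges R) + 1"
    using finR r reachR unfolding R_def by (intro card_reachable_le_card_edges[of _ _ r]) auto
  moreover have "card (?edges R) + card S \<le> card (undirected_edges G)"
  proof -
    let ?E = "(\<lambda>v. {v, f v}) ` S"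
    have "inj_on (\<lambda>v. {v, f v}) S"
      using f(1) by (auto intro!: inj_onI simp: doubleton_eq_iff)
    then have "card ?E = card S" by (rule card_image)
    moreover have "?edges R \<inter> ?E = {}"
      unfolding R_def K_def by (auto simp: doubleton_eq_iff)
    moreover have "?edges R \<union> ?E \<subseteq> undirected_edges G"
    proof -
      have "undirected_edges G = ?edges ?R"
        unfolding undirected_edges_def arcs_ends_conv by (auto simp: image_image)
      then show ?thesis using f(2) unfolding R_def by force
    qed
    moreover have "finite (undirected_edges G)" unfolding undirected_edges_def by simp
    moreover have "finite ?E" using S finite_subset[OF S] by simp
    moreover have "finite (?edges R)" using finR unfolding R_def by simp
    ultimately show ?thesis
      using card_Un_disjoint[of "?edges R" ?E]
        card_mono[of "undirected_edges G" "?edges R \<union> ?E"] by simp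
  qed
  ultimately show ?thesis by linarith
qed

text \<open>
  The bound depends on optimality only through the closure property \<open>return\<close>, which makes a
  set of least cardinality with property \<open>Q\<close> irredundant. This treats both optimisation problems
  at once.
\<close>
lemma exists_bounded_deletion_set:
  assumes conn: "connected G" and S: "Q S"
    and sub: "\<And>S. Q S \<Longrightarrow> S \<subseteq> verts G \<and> undirected_forest (del_verts G S)"
    and return: "\<And>S v. Q S \<Longrightarrow> v \<in> S \<Longrightarrow> undirected_forest (del_verts G (S - {v})) \<Longrightarrow> Q (S - {v})"
  shows "\<exists>S. Q S \<and> int (card S) \<le>
    int (card (undirected_edges G)) - int (card (verts G)) + 1"
proof -
  from S obtain T where T: "Q T" "\<And>S. Q S \<Longrightarrow> card T \<le> card S"
    using ex_has_least_nat[of Q S card] by blast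
  have "finite T" using sub[OF T(1)] finite_verts finite_subset by blast
  then have "\<not> undirected_forest (del_verts G (T - {v}))" if "v \<in> T" for v
    using that return[OF T(1) that] T(2)[of "T - {v}"] card_Diff1_less[of T v] by auto
  from irredundant_deletion_set_bound[OF conn _ _ this] sub[OF T(1)] T(1)
  show ?thesis by (intro exI[of _ T]) auto
qed

section \<open>Returning a vertex to an optimal deletion set\<close>

lemma path_cover_number_return_vertex:
  assumes "S \<subseteq> verts G" "v \<in> S"
  shows "path_cover_number (del_verts G (S - {v})) \<le> path_cover_number (del_verts G S) + 1"
    and "path_cover_number (del_verts G S) \<le> path_cover_number (del_verts G (S - {v})) + 1"
proof -
  have eq: "verts G - (S - {v}) = insert v (verts G - S)" using assms by auto
  have W: "finite (verts G - S)" "v \<notin> verts G - S" using assms(2) by auto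
  show "path_cover_number (del_verts G (S - {v})) \<le> path_cover_number (del_verts G S) + 1"
    unfolding del_verts_def eq using W by (rule path_cover_number_insert_le)
  show "path_cover_number (del_verts G S) \<le> path_cover_number (del_verts G (S - {v})) + 1"
    unfolding del_verts_def eq using W by (rule path_cover_number_le_insert)
qed

text \<open>Hence the extrema that define the two parameters range over nonempty sets.\<close>
lemma undirected_forest_del_all: "undirected_forest (del_verts G (verts G))"
  by (auto simp: undirected_forest_def del_verts_def pre_digraph.cycle_def pre_digraph.awalk_def)

lemma finite_deletion_values:
  "finite {h S |S. S \<subseteq> verts G \<and> undirected_forest (del_verts G S)}"
  by (rule finite_subset[of _ "h ` Pow (verts G)"]) auto

lemma T_plus_le:
  assumes "S \<subseteq> verts G" "undirected_forest (del_verts G S)"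
  shows "T_plus G \<le> int (path_cover_number (del_verts G S)) + int (card S)"
  unfolding T_plus_def by (rule Min_le[OF finite_deletion_values]) (use assms in blast)

lemma le_T_minus:
  assumes "S \<subseteq> verts G" "undirected_forest (del_verts G S)"
  shows "int (path_cover_number (del_verts G S)) - int (card S) \<le> T_minus G"
  unfolding T_minus_def by (rule Max_ge[OF finite_deletion_values]) (use assms in blast)

lemma optimal_T_plus_exists: "\<exists>S. optimal_T_plus G S"
proof -
  have "T_plus G \<in> {int (path_cover_number (del_verts G S)) + int (card S) |S.
     S \<subseteq> verts G \<and> undirected_forest (del_verts G S)}"
    unfolding T_plus_def
    by (rule Min_in[OF finite_deletion_values]) (use undirected_forest_del_all in blast)
  then show ?thesis unfolding optimal_T_plus_def by auto
qed

lemma optimal_T_minus_exists: "\<exists>S. optimal_T_minus G S"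
proof -
  have "T_minus G \<in> {int (path_cover_number (del_verts G S)) - int (card S) |S.
     S \<subseteq> verts G \<and> undirected_forest (del_verts G S)}"
    unfolding T_minus_def
    by (rule Max_in[OF finite_deletion_values]) (use undirected_forest_del_all in blast)
  then show ?thesis unfolding optimal_T_minus_def by auto
qed

lemma optimal_T_plus_return_vertex:
  assumes S: "optimal_T_plus G S" "v \<in> S" and forest: "undirected_forest (del_verts G (S - {v}))"
  shows "optimal_T_plus G (S - {v})"
proof -
  from S have sub: "S \<subseteq> verts G" and
    eq: "int (path_cover_number (del_verts G S)) + int (card S) = T_plus G"
    unfolding optimal_T_plus_def by auto
  have "int (card S) = int (card (S - {v})) + 1"
    using S(2) finite_subset[OF sub] card_Suc_Diff1[of S v] by simp
  moreover have sub': "S - {v} \<subseteq> verts G" using sub by auto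
  ultimately show ?thesis
    using T_plus_le[OF sub' forest] path_cover_number_return_vertex(1)[OF sub S(2)] eq sub' forest
    unfolding optimal_T_plus_def by simp
qed

lemma optimal_T_minus_return_vertex:
  assumes S: "optimal_T_minus G S" "v \<in> S" and forest: "undirected_forest (del_verts G (S - {v}))"
  shows "optimal_T_minus G (S - {v})"
proof -
  from S have sub: "S \<subseteq> verts G" and
    eq: "int (path_cover_number (del_verts G S)) - int (card S) = T_minus G"
    unfolding optimal_T_minus_def by auto
  have "int (card S) = int (card (S - {v})) + 1"
    using S(2) finite_subset[OF sub] card_Suc_Diff1[of S v] by simp
  moreover have sub': "S - {v} \<subseteq> verts G" using sub by auto
  ultimately show ?thesis
    using le_T_minus[OF sub' forest] path_cover_number_return_vertex(2)[OF sub S(2)] eq sub' forest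
    unfolding optimal_T_minus_def by simp
qed

end

theorem proposition4p3:
  fixes G :: "('a, 'b) pre_digraph" and n m :: nat
  assumes "graph G" and "connected G"
    and "n = card (verts G)" and "m = card (undirected_edges G)"
  shows "(\<exists>S. optimal_T_plus G S \<and> int (card S) \<le> int m - int n + 1) \<and>
         (\<exists>S. optimal_T_minus G S \<and> int (card S) \<le> int m - int n + 1)"
proof -
  interpret graph G by fact
  obtain S T where S: "optimal_T_plus G S" and T: "optimal_T_minus G T"
    using optimal_T_plus_exists optimal_T_minus_exists by blast
  have "\<exists>S. optimal_T_plus G S \<and> int (card S) \<le>
      int (card (undirected_edges G)) - int (card (verts G)) + 1"
    using \<open>connected G\<close> S
  proof (rule exists_bounded_deletion_set)
    show "S \<subseteq> verts G \<and> undirected_forest (del_verts G S)" if "optimal_T_plus G S" for S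
      using that unfolding optimal_T_plus_def by simp
  qed (rule optimal_T_plus_return_vertex)
  moreover have "\<exists>S. optimal_T_minus G S \<and> int (card S) \<le>
      int (card (undirected_edges G)) - int (card (verts G)) + 1"
    using \<open>connected G\<close> T
  proof (rule exists_bounded_deletion_set)
    show "S \<subseteq> verts G \<and> undirected_forest (del_verts G S)" if "optimal_T_minus G S" for S
      using that unfolding optimal_T_minus_def by simp
  qed (rule optimal_T_minus_return_vertex)
  ultimately show ?thesis using assms(3,4) by simp
qed

end
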